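(* Let $X$ be a topological graph. Then $\mathrm{Mix}(X)\cap\mathrm{CPE}(X)$ is a Borel subset of $\mathrm{TDS}(X)$.
   Context: A topological graph is a space of the form $X=\left(\bigcup_{n=1}^N[a_n,b_n]\right)/Q$, where $[a_1,b_1],\dots,[a_N,b_N]$ are finitely many pairwise disjoint intervals and $Q\subseteq\{a_1,\dots,a_N,b_1,\dots,b_N\}^2$ specifies the identifications of endpoints (the quotient is by the equivalence relation generated by $Q$). For a compact metrizable space $X$, $\mathrm{TDS}(X)$ is the Polish space of all continuous maps $T:X\to X$ with the topology of the sup metric. A topological dynamical system (TDS) is a pair $(X,T)$ with $X$ compact metrizable and $T:X\to X$ continuous. $(X,T)$ is mixing if for every pair of nonempty open sets $U,V\subseteq X$ there is $N>0$ such that $T^{-n}(U)\cap V\ne\emptyset$ for every $n\ge N$. $(X_2,T_2)$ is a factor of $(X_1,T_1)$ if there is a continuous surjection $\phi:X_1\to X_2$ with $\phi\circ T_1=T_2\circ\phi$. $(X,T)$ has completely positive entropy (CPE) if every non-trivial factor (i.e. factor whose space is not a single point) has positive topological entropy. $\mathrm{Mix}(X)$ and $\mathrm{CPE}(X)$ are the sets of $T\in\mathrm{TDS}(X)$ such that $(X,T)$ is mixing, respectively has CPE. *)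

theory Defs
  imports "HOL-Analysis.Analysis"
begin

section \<open>Topological graphs\<close>

text \<open>
  A quotient space is determined up to homeomorphism by a quotient map whose fibres are the
  classes of the relation, so \<open>X\<close> may live on any type.
\<close>

definition topological_graph :: "'a topology \<Rightarrow> bool" where
  "topological_graph X \<longleftrightarrow>
     (\<exists>(N::nat) (a :: nat \<Rightarrow> real) (b :: nat \<Rightarrow> real) (Q :: (real \<times> real) set) (q :: real \<Rightarrow> 'a).
        1 \<le> N \<and>
        (\<forall>n\<in>{1..N}. a n < b n) \<and>
        disjoint_family_on (\<lambda>n. {a n..b n}) {1..N} \<and>
        Q \<subseteq> (a ` {1..N} \<union> b ` {1..N}) \<times> (a ` {1..N} \<union> b ` {1..N}) \<and>
        quotient_map (top_of_set (\<Union>n\<in>{1..N}. {a n..b n})) X q \<and>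
        (\<forall>x\<in>(\<Union>n\<in>{1..N}. {a n..b n}). \<forall>y\<in>(\<Union>n\<in>{1..N}. {a n..b n}).
           q x = q y \<longleftrightarrow> equivclp (\<lambda>s t. (s, t) \<in> Q) x y))"


section \<open>Topological dynamical systems\<close>

definition tds :: "'a topology \<Rightarrow> ('a \<Rightarrow> 'a) \<Rightarrow> bool" where
  "tds X T \<longleftrightarrow> compact_space X \<and> metrizable_space X \<and> continuous_map X X T"

text \<open>
  Maps are taken to be \<open>extensional\<close>, so that self-maps of \<open>X\<close> are equal iff they agree on the
  points of \<open>X\<close>. For a metric \<open>m\<close> inducing \<open>X\<close>, the sup metric on this set is the library's
  \<open>cfunspace X m\<close>, see \<open>mspace_cfunspace_eq_TDS\<close> below.
\<close>

definition TDS :: "'a topology \<Rightarrow> ('a \<Rightarrow> 'a) set" where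
  "TDS X = {T. continuous_map X X T \<and> T \<in> extensional (topspace X)}"

definition mixing :: "'a topology \<Rightarrow> ('a \<Rightarrow> 'a) \<Rightarrow> bool" where
  "mixing X T \<longleftrightarrow>
     (\<forall>U V. openin X U \<and> U \<noteq> {} \<and> openin X V \<and> V \<noteq> {} \<longrightarrow>
        (\<exists>N>0. \<forall>n\<ge>N. {x \<in> topspace X. (T ^^ n) x \<in> U} \<inter> V \<noteq> {}))"

definition is_factor ::
    "'a topology \<Rightarrow> ('a \<Rightarrow> 'a) \<Rightarrow> 'b topology \<Rightarrow> ('b \<Rightarrow> 'b) \<Rightarrow> bool" where
  "is_factor X T Y S \<longleftrightarrow>
     (\<exists>\<phi>. continuous_map X Y \<phi> \<and> \<phi> ` topspace X = topspace Y \<and>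
          (\<forall>x\<in>topspace X. \<phi> (T x) = S (\<phi> x)))"


section \<open>Topological entropy\<close>

text \<open>This is the definition of Adler, Konheim and McAndrew.\<close>

definition open_cover :: "'a topology \<Rightarrow> 'a set set \<Rightarrow> bool" where
  "open_cover X \<U> \<longleftrightarrow> (\<forall>U\<in>\<U>. openin X U) \<and> topspace X \<subseteq> \<Union>\<U>"

definition cover_number :: "'a topology \<Rightarrow> 'a set set \<Rightarrow> nat" where
  "cover_number X \<U> =
     (LEAST k. \<exists>\<V>\<subseteq>\<U>. finite \<V> \<and> card \<V> = k \<and> topspace X \<subseteq> \<Union>\<V>)"

text \<open>The common refinement of the preimages of \<open>\<U>\<close> under \<open>T ^^ i\<close> for \<open>i < n\<close>.\<close>

definition cover_join :: "'a topology \<Rightarrow> ('a \<Rightarrow> 'a) \<Rightarrow> 'a set set \<Rightarrow> nat \<Rightarrow> 'a set set" where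
  "cover_join X T \<U> n =
     {{x \<in> topspace X. \<forall>i<n. (T ^^ i) x \<in> U i} | U. \<forall>i<n. U i \<in> \<U>}"

text \<open>The sequence converges by subadditivity, so the upper limit is the limit.\<close>

definition cover_entropy :: "'a topology \<Rightarrow> ('a \<Rightarrow> 'a) \<Rightarrow> 'a set set \<Rightarrow> ereal" where
  "cover_entropy X T \<U> =
     limsup (\<lambda>n. ereal (ln (real (cover_number X (cover_join X T \<U> n))) / real n))"

definition topological_entropy :: "'a topology \<Rightarrow> ('a \<Rightarrow> 'a) \<Rightarrow> ereal" where
  "topological_entropy X T = (SUP \<U>\<in>{\<U>. open_cover X \<U>}. cover_entropy X T \<U>)"


section \<open>Completely positive entropy\<close>

text \<open>
  A definition cannot quantify over all types. Every compact metrizable space is homeomorphic to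
  a subspace of \<open>\<real>\<^sup>\<nat>\<close>, so it suffices to let the factors range over spaces whose points are of
  type \<open>nat \<Rightarrow> real\<close>; \<open>has_CPE_factor\<close> below recovers the property for factors on any type.
\<close>

definition has_CPE :: "'a topology \<Rightarrow> ('a \<Rightarrow> 'a) \<Rightarrow> bool" where
  "has_CPE X T \<longleftrightarrow>
     (\<forall>(Y :: (nat \<Rightarrow> real) topology) S.
        tds Y S \<and> is_factor X T Y S \<and> \<not> (\<exists>y. topspace Y = {y}) \<longrightarrow>
        0 < topological_entropy Y S)"

definition Mix :: "'a topology \<Rightarrow> ('a \<Rightarrow> 'a) set" where
  "Mix X = {T \<in> TDS X. mixing X T}"

definition CPE :: "'a topology \<Rightarrow> ('a \<Rightarrow> 'a) set" where
  "CPE X = {T \<in> TDS X. has_CPE X T}"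

definition borel_sets_of :: "'a topology \<Rightarrow> 'a set set" where
  "borel_sets_of Z = sigma_sets (topspace Z) {U. openin Z U}"


section \<open>Consistency of the definitions\<close>

lemma mspace_cfunspace_eq_TDS:
  assumes "mtopology_of m = X" "compact_space X"
  shows "mspace (cfunspace X m) = TDS X"
proof -
  interpret M: Metric_space "mspace m" "mdist m" by simp
  have X: "X = M.mtopology" using assms(1) by (simp add: mtopology_of_def)
  have "M.mbounded (f ` topspace X)" if "continuous_map X X f" for f
  proof -
    have "compactin X (f ` topspace X)"
      using that assms(2) image_compactin compact_space_def by blast
    then show ?thesis using M.compactin_imp_mbounded X by blast
  qed
  moreover have "f \<in> topspace X \<rightarrow> mspace m" if "continuous_map X X f" for f
    using that X by (metis M.topspace_mtopology continuous_map_funspace)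
  ultimately show ?thesis
    using assms(1) by (auto simp: TDS_def)
qed

lemma compact_metrizable_homeomorphic_nat_real:
  assumes "compact_space (Y :: 'b topology)" "metrizable_space Y"
  obtains Z :: "(nat \<Rightarrow> real) topology" and h
  where "compact_space Z" "metrizable_space Z" "homeomorphic_map Y Z h"
proof (cases "topspace Y = {}")
  case True
  then have "Y = trivial_topology"
    using null_topspace_iff_trivial by blast
  then have "homeomorphic_map Y (trivial_topology :: (nat \<Rightarrow> real) topology) (\<lambda>_. undefined)"
    by (simp add: homeomorphic_map_def quotient_map_def)
  then show ?thesis using that
    by (metis compact_space_trivial_topology empty_metrizable_space)
next
  case False
  obtain M d where "Metric_space M d" and Y: "Y = Metric_space.mtopology M d"
    using assms(2) metrizable_space_def by metis
  then interpret Metric_space M d by simp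
  have top: "topspace Y = M" by (simp add: Y)
  have "mtotally_bounded M"
    using assms(1) Y by (metis compactin_imp_mtotally_bounded compact_space_def topspace_mtopology)
  then have "\<forall>n::nat. \<exists>K. finite K \<and> K \<subseteq> M \<and> M \<subseteq> (\<Union>x\<in>K. mball x (inverse (real (Suc n))))"
    unfolding mtotally_bounded_def by simp
  then obtain K where K: "\<And>n::nat. finite (K n)" "\<And>n. K n \<subseteq> M"
      "\<And>n::nat. M \<subseteq> (\<Union>x\<in>K n. mball x (inverse (real (Suc n))))"
    by metis
  define D where "D = (\<Union>n. K n)"
  have "countable D" using K(1) by (simp add: D_def countable_finite)
  moreover have "D \<noteq> {}" using K(3)[of 0] False top by (auto simp: D_def)
  ultimately obtain s :: "nat \<Rightarrow> 'b" where s: "range s = D"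
    by (metis uncountable_def)
  then have sM: "s n \<in> M" for n using K(2) D_def by blast
  define f where "f = (\<lambda>y n. d (s n) y)"
  let ?P = "powertop_real (UNIV :: nat set)"
  have cont: "continuous_map Y ?P f"
  proof (subst continuous_map_componentwise_UNIV, rule allI)
    fix n
    define m where "m = metric (M, d)"
    have "mspace m = M" "mdist m = d" "mtopology_of m = Y"
      by (simp_all add: m_def Y mtopology_of_def mspace_metric mdist_metric)
    then show "continuous_map Y euclideanreal (\<lambda>y. f y n)"
      using continuous_map_mdist[of Y m "\<lambda>_. s n" id] sM top by (simp add: f_def)
  qed
  have inj: "inj_on f (topspace Y)"
  proof (rule inj_onI)
    fix x y assume xy: "x \<in> topspace Y" "y \<in> topspace Y" "f x = f y"
    show "x = y"
    proof (rule ccontr)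
      assume "x \<noteq> y"
      then have "0 < d x y / 2" using xy top by simp
      then obtain n where n: "inverse (real (Suc n)) < d x y / 2"
        using reals_Archimedean by blast
      obtain k where k: "k \<in> K n" "x \<in> mball k (inverse (real (Suc n)))"
        using K(3) xy(1) top by blast
      then obtain j where j: "s j = k" using s D_def by (metis UN_I UNIV_I imageE)
      have "d k x = d k y" using xy(3) j unfolding f_def by metis
      moreover have "d k x < d x y / 2" using k(2) n by simp
      moreover have "d x y \<le> d x k + d k y"
        using triangle xy(1,2) k K(2) top by blast
      ultimately show False using commute[of x k] by linarith
    qed
  qed
  have haus: "Hausdorff_space ?P"
    by (simp add: Hausdorff_space_product_topology)
  have "embedding_map Y ?P f"
    using injective_closed_imp_embedding_map[OF cont _ inj]
      continuous_imp_closed_map[OF cont assms(1) haus] by blast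
  then have hm: "homeomorphic_map Y (subtopology ?P (f ` topspace Y)) f"
    by (simp add: embedding_map_def)
  then have "Y homeomorphic_space subtopology ?P (f ` topspace Y)"
    by (rule homeomorphic_map_imp_homeomorphic_space)
  then have "compact_space (subtopology ?P (f ` topspace Y))"
      "metrizable_space (subtopology ?P (f ` topspace Y))"
    using assms homeomorphic_compact_space homeomorphic_metrizable_space by blast+
  then show ?thesis using that hm by blast
qed

lemma funpow_topspace:
  assumes "continuous_map X X T" "x \<in> topspace X"
  shows "(T ^^ i) x \<in> topspace X"
  using assms by (induction i) (auto simp: continuous_map_def Pi_iff)

lemma topological_entropy_factor_le:
  fixes X :: "'a topology" and Y :: "'b topology"
  assumes X: "tds X T" and fac: "is_factor X T Y S"
  shows "topological_entropy Y S \<le> topological_entropy X T"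
proof -
  obtain \<phi> where cont: "continuous_map X Y \<phi>" and surj: "\<phi> ` topspace X = topspace Y"
      and com: "\<And>x. x \<in> topspace X \<Longrightarrow> \<phi> (T x) = S (\<phi> x)"
    using fac unfolding is_factor_def by blast
  have TX: "continuous_map X X T" and comp: "compact_space X"
    using X unfolding tds_def by auto
  have iter: "\<phi> ((T ^^ i) x) = (S ^^ i) (\<phi> x)" if "x \<in> topspace X" for i x
    using that by (induction i) (simp_all add: com funpow_topspace[OF TX])
  define pull where "pull = (\<lambda>U. {x \<in> topspace X. \<phi> x \<in> U})"
  have main: "cover_entropy Y S \<U> \<le> topological_entropy X T" if \<U>: "open_cover Y \<U>" for \<U>
  proof -
    have oc: "open_cover X (pull ` \<U>)"
      unfolding open_cover_def
    proof (intro conjI ballI subsetI)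
      fix A assume "A \<in> pull ` \<U>"
      then show "openin X A"
        using \<U> cont unfolding open_cover_def pull_def
        by (auto intro: openin_continuous_map_preimage)
    next
      fix x assume x: "x \<in> topspace X"
      then have "\<phi> x \<in> topspace Y" using surj by blast
      then obtain U where "U \<in> \<U>" "\<phi> x \<in> U"
        using \<U> unfolding open_cover_def by blast
      then show "x \<in> \<Union> (pull ` \<U>)" using x by (auto simp: pull_def)
    qed
    have num: "cover_number Y (cover_join Y S \<U> n) \<le> cover_number X (cover_join X T (pull ` \<U>) n)"
      for n
    proof -
      let ?A = "cover_join X T (pull ` \<U>) n" and ?B = "cover_join Y S \<U> n"
      have AB: "?A \<subseteq> pull ` ?B"
      proof
        fix A assume "A \<in> ?A"
        then obtain U where U: "\<forall>i<n. U i \<in> pull ` \<U>"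
            and A: "A = {x \<in> topspace X. \<forall>i<n. (T ^^ i) x \<in> U i}"
          unfolding cover_join_def by blast
        obtain W where W: "\<And>i. i < n \<Longrightarrow> W i \<in> \<U> \<and> U i = pull (W i)"
          using U unfolding image_iff by metis
        have "A = pull {y \<in> topspace Y. \<forall>i<n. (S ^^ i) y \<in> W i}"
          using surj by (auto simp: A W pull_def iter funpow_topspace[OF TX])
        moreover have "{y \<in> topspace Y. \<forall>i<n. (S ^^ i) y \<in> W i} \<in> ?B"
          using W unfolding cover_join_def by blast
        ultimately show "A \<in> pull ` ?B" by blast
      qed
      have openA: "openin X A" if A_in: "A \<in> ?A" for A
      proof -
        obtain U where U: "\<forall>i<n. U i \<in> pull ` \<U>"
            and A: "A = {x \<in> topspace X. \<forall>i<n. (T ^^ i) x \<in> U i}"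
          using A_in unfolding cover_join_def by blast
        have Ti: "continuous_map X X (T ^^ i)" for i
        proof (induction i)
          case (Suc i)
          then show ?case
            using continuous_map_compose[OF Suc TX] by (simp add: o_def)
        qed (simp add: id_def)
        have "openin X {x \<in> topspace X. (T ^^ i) x \<in> U i}" if "i < n" for i
          using U oc that Ti unfolding open_cover_def
          by (intro openin_continuous_map_preimage[OF Ti]) auto
        then have "openin X (topspace X \<inter> (\<Inter>i\<in>{..<n}. {x \<in> topspace X. (T ^^ i) x \<in> U i}))"
          by (cases "n = 0") (auto intro!: openin_Int openin_INT2)
        moreover have "A = topspace X \<inter> (\<Inter>i\<in>{..<n}. {x \<in> topspace X. (T ^^ i) x \<in> U i})"
          unfolding A by auto
        ultimately show ?thesis by simp
      qed
      have covA: "topspace X \<subseteq> \<Union>?A"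
      proof
        fix x assume x: "x \<in> topspace X"
        have "\<exists>U. U \<in> pull ` \<U> \<and> (T ^^ i) x \<in> U" for i
        proof -
          have "(T ^^ i) x \<in> \<Union> (pull ` \<U>)"
            using oc funpow_topspace[OF TX x] unfolding open_cover_def by (meson subsetD)
          then show ?thesis by (meson UnionE)
        qed
        then obtain U where U: "\<And>i. U i \<in> pull ` \<U> \<and> (T ^^ i) x \<in> U i" by metis
        then have "{z \<in> topspace X. \<forall>i<n. (T ^^ i) z \<in> U i} \<in> ?A"
          unfolding cover_join_def by (intro CollectI exI[of _ U]) simp
        moreover have "x \<in> {z \<in> topspace X. \<forall>i<n. (T ^^ i) z \<in> U i}" using U x by simp
        ultimately show "x \<in> \<Union>?A" by (meson UnionI)
      qed
      define P where "P = (\<lambda>k. \<exists>\<V>\<subseteq>?A. finite \<V> \<and> card \<V> = k \<and> topspace X \<subseteq> \<Union>\<V>)"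
      have "\<exists>\<V>. finite \<V> \<and> \<V> \<subseteq> ?A \<and> topspace X \<subseteq> \<Union>\<V>"
        using comp openA covA unfolding compact_space_alt by blast
      then have "Ex P" unfolding P_def by blast
      then have "P (cover_number X ?A)"
        unfolding cover_number_def P_def[symmetric] by (meson LeastI_ex)
      then obtain \<V> where \<V>: "\<V> \<subseteq> ?A" "finite \<V>" "card \<V> = cover_number X ?A"
          "topspace X \<subseteq> \<Union>\<V>"
        unfolding P_def by blast
      have "\<exists>B. B \<in> ?B \<and> A = pull B" if "A \<in> \<V>" for A
        using subsetD[OF AB subsetD[OF \<V>(1) that]] by (simp add: image_iff Bex_def)
      then obtain r where r: "\<And>A. A \<in> \<V> \<Longrightarrow> r A \<in> ?B \<and> A = pull (r A)"
        by metis
      have "topspace Y \<subseteq> \<Union>(r ` \<V>)"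
      proof
        fix y assume "y \<in> topspace Y"
        then obtain x where x: "x \<in> topspace X" "y = \<phi> x" using surj by blast
        then obtain A where A: "A \<in> \<V>" "x \<in> A" using \<V>(4) by blast
        then have "x \<in> pull (r A)" using r by blast
        then show "y \<in> \<Union>(r ` \<V>)" using A x by (auto simp: pull_def)
      qed
      then have "cover_number Y ?B \<le> card (r ` \<V>)"
        unfolding cover_number_def using r \<V>(2)
        by (intro Least_le exI[of _ "r ` \<V>"]) auto
      also have "\<dots> \<le> cover_number X ?A" using \<V> card_image_le by metis
      finally show ?thesis .
    qed
    have lnmono: "ln (real k) \<le> ln (real l)" if "k \<le> l" for k l :: nat
      using that by (cases "k = 0"; cases "l = 0") (auto simp: ln_mono)
    have "cover_entropy Y S \<U> \<le> cover_entropy X T (pull ` \<U>)"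
      unfolding cover_entropy_def
      by (intro Limsup_mono always_eventually allI)
         (simp add: divide_right_mono lnmono num)
    also have "\<dots> \<le> topological_entropy X T"
      unfolding topological_entropy_def using oc by (auto intro: SUP_upper)
    finally show ?thesis .
  qed
  then show ?thesis
    unfolding topological_entropy_def[of Y] by (auto intro: SUP_least)
qed

lemma has_CPE_factor:
  fixes X :: "'a topology" and Y :: "'b topology"
  assumes cpe: "has_CPE X T"
    and Y: "tds Y S" and fac: "is_factor X T Y S" and nontriv: "\<not> (\<exists>y. topspace Y = {y})"
  shows "0 < topological_entropy Y S"
proof -
  obtain Z :: "(nat \<Rightarrow> real) topology" and h where Z: "compact_space Z" "metrizable_space Z"
      and "homeomorphic_map Y Z h"
    using Y compact_metrizable_homeomorphic_nat_real unfolding tds_def by metis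
  then obtain g where hg: "homeomorphic_maps Y Z h g"
    using homeomorphic_map_maps by blast
  then have h: "continuous_map Y Z h" and g: "continuous_map Z Y g"
      and gh: "\<And>y. y \<in> topspace Y \<Longrightarrow> g (h y) = y"
      and hg': "\<And>z. z \<in> topspace Z \<Longrightarrow> h (g z) = z"
    unfolding homeomorphic_maps_def by auto
  have h_top: "h ` topspace Y = topspace Z"
    using h g hg' by (force simp: continuous_map_def Pi_iff)
  define S' where "S' = h \<circ> S \<circ> g"
  have S: "continuous_map Y Y S" using Y unfolding tds_def by simp
  have S': "continuous_map Z Z S'"
    unfolding S'_def using h g S by (meson continuous_map_compose)
  then have tdsZ: "tds Z S'" using Z by (simp add: tds_def)
  have facYZ: "is_factor Y S Z S'"
    unfolding is_factor_def using h h_top gh by (intro exI[of _ h]) (auto simp: S'_def)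
  have "is_factor X T Z S'"
  proof -
    obtain \<phi> where \<phi>: "continuous_map X Y \<phi>" "\<phi> ` topspace X = topspace Y"
        "\<forall>x\<in>topspace X. \<phi> (T x) = S (\<phi> x)"
      using fac unfolding is_factor_def by blast
    have "(h \<circ> \<phi>) ` topspace X = topspace Z" using \<phi>(2) h_top by (metis image_comp)
    moreover have "\<phi> x \<in> topspace Y" if "x \<in> topspace X" for x using \<phi>(2) that by blast
    ultimately show ?thesis
      unfolding is_factor_def using \<phi> h gh
      by (intro exI[of _ "h \<circ> \<phi>"]) (auto simp: S'_def intro: continuous_map_compose)
  qed
  moreover have "\<not> (\<exists>z. topspace Z = {z})"
  proof
    assume "\<exists>z. topspace Z = {z}"
    then obtain z where z: "topspace Z = {z}" by blast
    have "y = g z" if "y \<in> topspace Y" for y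
      using that gh[OF that] h_top z by (metis imageI singletonD)
    moreover have "g z \<in> topspace Y" using g z by (auto simp: continuous_map_def)
    ultimately show False using nontriv by blast
  qed
  ultimately have "0 < topological_entropy Z S'"
    using cpe tdsZ unfolding has_CPE_def by blast
  also have "\<dots> \<le> topological_entropy Y S"
    using topological_entropy_factor_le[OF Y facYZ] .
  finally show ?thesis .
qed

end

theory Submission
  imports Defs
begin

text \<open>
  On a topological graph every mixing map has completely positive entropy, so the intersection
  in question is just the set of mixing maps, and mixing is a Borel condition on every compact
  metric space.

  Mixing is Borel because it need only be tested on a countable \<open>\<pi>\<close>-base \<open>\<B>\<close>: it is the countable
  combination \<open>\<Inter>(U, V). \<Union>N. \<Inter>n\<ge>N\<close> of the conditions that \<open>T ^^ n\<close> carries a point of \<open>V\<close> into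
  \<open>U\<close>, and each of these is open since \<open>T \<mapsto> (T ^^ n) x\<close> is continuous for the sup metric
  (\<open>continuous_map_eval_funpow\<close>, \<open>mixing_pi_base\<close>, \<open>Mix_borel\<close>).

  For the entropy, let \<open>\<phi>\<close> be a factor map of a mixing \<open>T\<close> onto a space with two points, and
  separate these by disjoint open sets. Their preimages under \<open>\<phi>\<close> contain pieces of edges, which
  are cut into a left part, a middle part and a right part. For large \<open>n\<close>, mixing makes the image
  under \<open>T ^^ n\<close> of each of the four outer parts meet both middle parts. These images are
  connected, and a connected set that meets the middle part of an edge piece but is not contained
  in the piece must leave it through one of its ends, so it covers the left part or the right part
  (\<open>free_arc_cover_outer_part\<close>). Which of the two is covered does not matter: from any outer part
  one can move, by covering, to an outer part over either open set. Hence every sequence of the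
  two open sets is followed by some orbit of \<open>T ^^ n\<close> (\<open>covering_relation_itinerary\<close>). In the
  factor this is a horseshoe, which forces entropy at least \<open>ln 2 / n\<close>
  (\<open>horseshoe_positive_entropy\<close>).
\<close>

section \<open>Mixing is a Borel condition\<close>

lemma continuous_map_funpow:
  assumes "continuous_map X X T"
  shows "continuous_map X X (T ^^ n)"
proof (induction n)
  case (Suc n)
  then show ?case
    using continuous_map_compose[OF Suc assms] by (simp add: o_def)
qed (simp add: id_def)

text \<open>
  By total boundedness, finitely many balls of radius \<open>1 / (n + 1)\<close> cover the space; all these
  balls together form a \<open>\<pi>\<close>-base.
\<close>

lemma compact_metric_countable_pi_base:
  assumes "mtopology_of m = X" and "compact_space X"
  obtains \<B> where "countable \<B>" and "\<And>B. B \<in> \<B> \<Longrightarrow> openin X B \<and> B \<noteq> {}"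
    and "\<And>W. openin X W \<Longrightarrow> W \<noteq> {} \<Longrightarrow> \<exists>B\<in>\<B>. B \<subseteq> W"
proof -
  interpret M: Metric_space "mspace m" "mdist m" by simp
  have X: "X = M.mtopology" using assms(1) by (simp add: mtopology_of_def)
  have "M.mtotally_bounded (mspace m)"
    using assms(2) X M.compactin_imp_mtotally_bounded by (metis compact_space_def M.topspace_mtopology)
  then have "\<forall>n::nat. \<exists>K. finite K \<and> K \<subseteq> mspace m \<and>
      mspace m \<subseteq> (\<Union>x\<in>K. M.mball x (inverse (real (Suc n))))"
    unfolding M.mtotally_bounded_def by simp
  then obtain K where K: "\<And>n::nat. finite (K n)" "\<And>n. K n \<subseteq> mspace m"
      "\<And>n::nat. mspace m \<subseteq> (\<Union>x\<in>K n. M.mball x (inverse (real (Suc n))))"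
    by metis
  define \<B> where "\<B> = (\<Union>n. (\<lambda>x. M.mball x (inverse (real (Suc n)))) ` K n)"
  show ?thesis
  proof
    show "countable \<B>"
      unfolding \<B>_def by (intro countable_UN countableI_type countable_finite finite_imageI K(1))
    show "openin X B \<and> B \<noteq> {}" if B: "B \<in> \<B>" for B
    proof -
      obtain n x where x: "x \<in> K n" "B = M.mball x (inverse (real (Suc n)))"
        using B unfolding \<B>_def by blast
      then have "x \<in> B" using subsetD[OF K(2) x(1)] by simp
      then show ?thesis using x(2) X M.openin_mball by blast
    qed
    show "\<exists>B\<in>\<B>. B \<subseteq> W" if W: "openin X W" "W \<noteq> {}" for W
    proof -
      obtain x e where x: "x \<in> mspace m" and e: "e > 0" "M.mball x e \<subseteq> W"
        using W unfolding X M.openin_mtopology by blast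
      obtain n where n: "inverse (real (Suc n)) < e / 2"
        using reals_Archimedean[of "e / 2"] e by auto
      obtain k where k: "k \<in> K n" "x \<in> M.mball k (inverse (real (Suc n)))"
        using K(3) x by blast
      have "M.mball k (inverse (real (Suc n))) \<subseteq> M.mball x e"
      proof
        fix y assume y: "y \<in> M.mball k (inverse (real (Suc n)))"
        have "mdist m x y \<le> mdist m x k + mdist m k y"
          using M.triangle x y k K(2) by auto
        then show "y \<in> M.mball x e" using x y k n M.commute[of x k] by auto
      qed
      then show ?thesis using e(2) k(1) unfolding \<B>_def by blast
    qed
  qed
qed

text \<open>
  The induction compares \<open>T ((T ^^ n) x)\<close> with \<open>S ((S ^^ n) x)\<close> through \<open>T ((S ^^ n) x)\<close>: the first
  two are close by continuity of \<open>T\<close> and the induction hypothesis, the last two by the sup metric.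
\<close>

lemma continuous_map_eval_funpow:
  assumes m: "mtopology_of m = X" and X: "compact_space X" and x: "x \<in> topspace X"
  shows "continuous_map (mtopology_of (cfunspace X m)) X (\<lambda>T. (T ^^ n) x)"
proof -
  interpret M: Metric_space "mspace m" "mdist m" by simp
  interpret F: Metric_space "mspace (cfunspace X m)" "mdist (cfunspace X m)"
    by (rule Metric_space_mspace_mdist)
  have XM: "X = M.mtopology" using m by (simp add: mtopology_of_def)
  have top: "topspace X = mspace m" using XM by simp
  have sp: "mspace (cfunspace X m) = TDS X"
    using mspace_cfunspace_eq_TDS m X by blast
  have tdsD: "continuous_map X X T" if "T \<in> TDS X" for T using that by (simp add: TDS_def)
  show ?thesis
  proof (induction n)
    case 0
    then show ?case using x by simp
  next
    case (Suc n)
    have "continuous_map F.mtopology M.mtopology (\<lambda>T. (T ^^ Suc n) x)"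
      unfolding F.metric_continuous_map[OF M.Metric_space_axioms]
    proof (intro conjI ballI allI impI subsetI)
      fix y assume "y \<in> (\<lambda>T. (T ^^ Suc n) x) ` mspace (cfunspace X m)"
      then obtain T where "T \<in> TDS X" "y = (T ^^ Suc n) x" unfolding sp by blast
      then show "y \<in> mspace m" using funpow_topspace[OF tdsD x] top by blast
    next
      fix T and e :: real assume "T \<in> mspace (cfunspace X m)" and e: "e > 0"
      then have T: "T \<in> TDS X" unfolding sp by blast
      have pT: "(T ^^ n) x \<in> mspace m" using funpow_topspace[OF tdsD[OF T] x] top by blast
      have "\<forall>a\<in>mspace m. \<forall>e>0. \<exists>\<delta>>0. \<forall>z. z \<in> mspace m \<and> mdist m a z < \<delta> \<longrightarrow> mdist m (T a) (T z) < e"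
        using tdsD[OF T] unfolding XM M.metric_continuous_map[OF M.Metric_space_axioms] by blast
      then obtain d where d: "d > 0"
        "\<And>z. z \<in> mspace m \<Longrightarrow> mdist m ((T ^^ n) x) z < d \<Longrightarrow> mdist m (T ((T ^^ n) x)) (T z) < e / 2"
        using pT e by (metis half_gt_zero)
      have "continuous_map F.mtopology M.mtopology (\<lambda>T. (T ^^ n) x)"
        using Suc XM by (simp add: mtopology_of_def)
      then obtain d' where d': "d' > 0"
        "\<And>S. S \<in> TDS X \<Longrightarrow> mdist (cfunspace X m) T S < d' \<Longrightarrow> mdist m ((T ^^ n) x) ((S ^^ n) x) < d"
        unfolding F.metric_continuous_map[OF M.Metric_space_axioms]
        using T d(1) unfolding sp[symmetric] by meson
      show "\<exists>\<delta>>0. \<forall>S. S \<in> mspace (cfunspace X m) \<and> mdist (cfunspace X m) T S < \<delta> \<longrightarrow>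
              mdist m ((T ^^ Suc n) x) ((S ^^ Suc n) x) < e"
      proof (intro exI[of _ "min d' (e / 2)"] conjI allI impI)
        show "0 < min d' (e / 2)" using d' e by simp
        fix S assume S: "S \<in> mspace (cfunspace X m) \<and> mdist (cfunspace X m) T S < min d' (e / 2)"
        then have ST: "S \<in> TDS X" unfolding sp by blast
        define z where "z = (S ^^ n) x"
        have z: "z \<in> mspace m" using funpow_topspace[OF tdsD[OF ST] x] top z_def by blast
        have "mdist m (T ((T ^^ n) x)) (T z) < e / 2"
          using d(2)[OF z] d'(2)[OF ST] S z_def by simp
        moreover have "mdist m (T z) (S z) \<le> e / 2"
          using mdist_cfunspace_imp_mdist_le[of T X m S "e / 2" z] T ST S z unfolding sp top by simp
        moreover have "mdist m (T ((T ^^ n) x)) (S z) \<le> mdist m (T ((T ^^ n) x)) (T z) + mdist m (T z) (S z)"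
          using M.triangle funpow_topspace[OF tdsD[OF T], of _ 1] funpow_topspace[OF tdsD[OF ST], of _ 1]
            z pT top by simp
        ultimately show "mdist m ((T ^^ Suc n) x) ((S ^^ Suc n) x) < e"
          by (simp add: z_def)
      qed
    qed
    then show ?case using XM by (simp add: mtopology_of_def)
  qed
qed

lemma mixing_pi_base:
  assumes open_base: "\<And>B. B \<in> \<B> \<Longrightarrow> openin X B \<and> B \<noteq> {}"
    and pi_base: "\<And>W. openin X W \<Longrightarrow> W \<noteq> {} \<Longrightarrow> \<exists>B\<in>\<B>. B \<subseteq> W"
  shows "mixing X T \<longleftrightarrow> (\<forall>(U, V)\<in>\<B> \<times> \<B>. \<exists>N>0. \<forall>n\<ge>N. \<exists>x\<in>V. (T ^^ n) x \<in> U)"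
    (is "_ \<longleftrightarrow> ?R")
proof
  assume T: "mixing X T"
  show ?R
  proof clarify
    fix U V assume UV: "U \<in> \<B>" "V \<in> \<B>"
    then have "\<exists>N>0. \<forall>n\<ge>N. {x \<in> topspace X. (T ^^ n) x \<in> U} \<inter> V \<noteq> {}"
      using T open_base unfolding mixing_def by simp
    then show "\<exists>N>0. \<forall>n\<ge>N. \<exists>x\<in>V. (T ^^ n) x \<in> U" by blast
  qed
next
  assume R: ?R
  show "mixing X T"
    unfolding mixing_def
  proof clarify
    fix U V assume UV: "openin X U" "U \<noteq> {}" "openin X V" "V \<noteq> {}"
    obtain U' V' where sub: "U' \<in> \<B>" "U' \<subseteq> U" "V' \<in> \<B>" "V' \<subseteq> V"
      using pi_base UV by meson
    then obtain N where N: "N > 0" "\<And>n. n \<ge> N \<Longrightarrow> \<exists>x\<in>V'. (T ^^ n) x \<in> U'"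
      using R by blast
    have "V' \<subseteq> topspace X" using open_base sub openin_subset by blast
    then have "\<forall>n\<ge>N. {x \<in> topspace X. (T ^^ n) x \<in> U} \<inter> V \<noteq> {}"
      using N(2) sub by blast
    then show "\<exists>N>0. \<forall>n\<ge>N. {x \<in> topspace X. (T ^^ n) x \<in> U} \<inter> V \<noteq> {}" using N(1) by blast
  qed
qed

lemma Mix_borel:
  assumes m: "mtopology_of m = X" and X: "compact_space X"
  shows "Mix X \<in> borel_sets_of (mtopology_of (cfunspace X m))"
proof -
  define Z where "Z = mtopology_of (cfunspace X m)"
  have topZ: "topspace Z = TDS X"
    using mspace_cfunspace_eq_TDS[OF m X] by (simp add: Z_def)
  interpret sigma_algebra "topspace Z" "borel_sets_of Z"
    unfolding borel_sets_of_def by (rule sigma_algebra_sigma_sets) (auto dest: openin_subset)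
  obtain \<B> where \<B>: "countable \<B>" "\<And>B. B \<in> \<B> \<Longrightarrow> openin X B \<and> B \<noteq> {}"
      "\<And>W. openin X W \<Longrightarrow> W \<noteq> {} \<Longrightarrow> \<exists>B\<in>\<B>. B \<subseteq> W"
    using compact_metric_countable_pi_base[OF m X] by blast
  define H where "H = (\<lambda>U V n. {T \<in> TDS X. \<exists>x\<in>V. (T ^^ n) x \<in> U})"
  have H: "H U V n \<in> borel_sets_of Z" if UV: "U \<in> \<B>" "V \<in> \<B>" for U V n
  proof -
    have "V \<subseteq> topspace X" using \<B>(2) UV openin_subset by blast
    then have "openin Z {T \<in> topspace Z. (T ^^ n) x \<in> U}" if "x \<in> V" for x
      using openin_continuous_map_preimage[OF continuous_map_eval_funpow[OF m X]] \<B>(2) UV that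
      unfolding Z_def by blast
    then have "openin Z (\<Union>x\<in>V. {T \<in> topspace Z. (T ^^ n) x \<in> U})" by blast
    also have "(\<Union>x\<in>V. {T \<in> topspace Z. (T ^^ n) x \<in> U}) = H U V n"
      unfolding H_def topZ by blast
    finally show ?thesis unfolding borel_sets_of_def by blast
  qed
  have tail: "(\<Inter>n\<in>{N..}. H U V n) \<in> borel_sets_of Z" if "U \<in> \<B>" "V \<in> \<B>" for U V and N :: nat
    using H[OF that] by (intro countable_INT') auto
  have pair: "(\<Union>N\<in>{0<..}. \<Inter>n\<in>{N..}. H U V n) \<in> borel_sets_of Z" if "U \<in> \<B>" "V \<in> \<B>" for U V
    using tail[OF that] by (intro countable_UN) auto
  have "topspace Z \<inter> (\<Inter>(U, V)\<in>\<B> \<times> \<B>. \<Union>N\<in>{0<..}. \<Inter>n\<in>{N..}. H U V n) \<in> borel_sets_of Z"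
  proof (cases "\<B> = {}")
    case False
    then show ?thesis
      using pair \<B>(1) by (intro Int top countable_INT') auto
  qed (simp add: top)
  also have "topspace Z \<inter> (\<Inter>(U, V)\<in>\<B> \<times> \<B>. \<Union>N\<in>{0<..}. \<Inter>n\<in>{N..}. H U V n) = Mix X"
  proof (rule set_eqI)
    fix T
    have "T \<in> (\<Union>N\<in>{0<..}. \<Inter>n\<in>{N..}. H U V n) \<longleftrightarrow> (\<exists>N>0. \<forall>n\<ge>N. \<exists>x\<in>V. (T ^^ n) x \<in> U)"
      if "T \<in> TDS X" for U V
      using that by (simp add: H_def Bex_def) (simp add: Ball_def)
    moreover have mix: "mixing X T \<longleftrightarrow> (\<forall>(U, V)\<in>\<B> \<times> \<B>. \<exists>N>0. \<forall>n\<ge>N. \<exists>x\<in>V. (T ^^ n) x \<in> U)"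
      using \<B>(2,3) by (rule mixing_pi_base)
    ultimately show "T \<in> topspace Z \<inter> (\<Inter>(U, V)\<in>\<B> \<times> \<B>. \<Union>N\<in>{0<..}. \<Inter>n\<in>{N..}. H U V n) \<longleftrightarrow> T \<in> Mix X"
      unfolding Mix_def mem_Collect_eq Int_iff INT_iff topZ mix case_prod_unfold by meson
  qed
  finally show ?thesis unfolding Z_def .
qed

section \<open>Free arcs in a topological graph\<close>

text \<open>
  A piece of an edge on which the graph looks like an interval of the line: subintervals of
  \<open>{s..t}\<close> keep their openness and closedness when they are mapped to \<open>X\<close>.
\<close>

definition free_arc :: "'a topology \<Rightarrow> (real \<Rightarrow> 'a) \<Rightarrow> real \<Rightarrow> real \<Rightarrow> bool" where
  "free_arc X q s t \<longleftrightarrow>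
     s < t \<and> continuous_map (top_of_set {s..t}) X q \<and>
     (\<forall>u v. s \<le> u \<and> v \<le> t \<longrightarrow> openin X (q ` {u<..<v}) \<and> closedin X (q ` {u..v}))"

lemma equivclp_neq_related:
  assumes "equivclp r x y" "x \<noteq> y"
  shows "\<exists>z. r z y \<or> r y z"
  using assms by (induction rule: equivclp_induct) auto

lemma topological_graph_compact_nonempty:
  assumes "topological_graph X"
  shows "compact_space X" and "topspace X \<noteq> {}"
proof -
  obtain N :: nat and a b :: "nat \<Rightarrow> real" and q :: "real \<Rightarrow> 'a"
    where N: "1 \<le> N" "\<forall>n\<in>{1..N}. a n < b n"
      and q: "quotient_map (top_of_set (\<Union>n\<in>{1..N}. {a n..b n})) X q"
    using assms unfolding topological_graph_def by blast
  let ?E = "\<Union>n\<in>{1..N}. {a n..b n}"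
  have im: "q ` ?E = topspace X" using q by (simp add: quotient_map_def)
  have "compactin (top_of_set ?E) ?E"
    by (simp add: compactin_subtopology compact_UN)
  then have "compactin X (q ` ?E)"
    using image_compactin quotient_imp_continuous_map[OF q] by blast
  then show "compact_space X" unfolding im compact_space_def .
  have "a 1 \<in> ?E" using N by (intro UN_I[of 1]) (auto intro: less_imp_le)
  then show "topspace X \<noteq> {}" using im by blast
qed

text \<open>
  The quotient map is injective off the endpoints: distinct equivalent points both occur in \<open>Q\<close>,
  hence are endpoints. So subsets of the interior of an edge are saturated, and a short interval
  there keeps its topology in \<open>X\<close>.
\<close>

lemma topological_graph_free_arcs:
  assumes "topological_graph X"
  obtains q where "\<And>W. openin X W \<Longrightarrow> W \<noteq> {} \<Longrightarrow> \<exists>s t. free_arc X q s t \<and> q ` {s..t} \<subseteq> W"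
proof -
  obtain N :: nat and a b :: "nat \<Rightarrow> real" and Q and q :: "real \<Rightarrow> 'a"
    where N: "1 \<le> N" and ab: "\<forall>n\<in>{1..N}. a n < b n"
      and disj: "disjoint_family_on (\<lambda>n. {a n..b n}) {1..N}"
      and Q: "Q \<subseteq> (a ` {1..N} \<union> b ` {1..N}) \<times> (a ` {1..N} \<union> b ` {1..N})"
      and q: "quotient_map (top_of_set (\<Union>n\<in>{1..N}. {a n..b n})) X q"
      and ker: "\<forall>x\<in>(\<Union>n\<in>{1..N}. {a n..b n}). \<forall>y\<in>(\<Union>n\<in>{1..N}. {a n..b n}).
           q x = q y \<longleftrightarrow> equivclp (\<lambda>s t. (s, t) \<in> Q) x y"
    using assms unfolding topological_graph_def by blast
  define E where "E = (\<Union>n\<in>{1..N}. {a n..b n})"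
  have im: "q ` E = topspace X" using q by (simp add: quotient_map_def E_def)
  have openq: "openin (top_of_set E) {x \<in> E. q x \<in> U} \<longleftrightarrow> openin X U" if "U \<subseteq> topspace X" for U
    using q that by (simp add: quotient_map_def E_def)
  have inner: "z = y" if n: "n \<in> {1..N}" "a n < y" "y < b n" and z: "z \<in> E" "q z = q y" for n y z
  proof (rule ccontr)
    assume "z \<noteq> y"
    moreover have "y \<in> E" using n unfolding E_def by (auto intro!: bexI[of _ n])
    ultimately have "equivclp (\<lambda>s t. (s, t) \<in> Q) z y" using ker z unfolding E_def by blast
    then have "y \<in> a ` {1..N} \<union> b ` {1..N}"
      using equivclp_neq_related \<open>z \<noteq> y\<close> Q by fastforce
    then obtain k where k: "k \<in> {1..N}" "y = a k \<or> y = b k" by blast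
    then have "y \<in> {a k..b k} \<inter> {a n..b n}" using n ab by (auto intro: less_imp_le)
    then have "k = n" using disj k n unfolding disjoint_family_on_def by blast
    then show False using k n by simp
  qed
  have sub: "{a n<..<b n} \<subseteq> E" if "n \<in> {1..N}" for n
    using that greaterThanLessThan_subseteq_atLeastAtMost_iff unfolding E_def by blast
  \<comment> \<open>Saturation lets openness in \<open>X\<close> be read off from openness in \<open>E\<close>.\<close>
  have sat: "{x \<in> E. q x \<in> q ` S} = S" if "n \<in> {1..N}" "S \<subseteq> {a n<..<b n}" for n S
  proof
    show "{x \<in> E. q x \<in> q ` S} \<subseteq> S"
    proof
      fix x assume "x \<in> {x \<in> E. q x \<in> q ` S}"
      then obtain y where y: "x \<in> E" "y \<in> S" "q x = q y" by blast
      then have "x = y" using inner[OF that(1), of y x] that(2) by auto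
      then show "x \<in> S" using y(2) by simp
    qed
    show "S \<subseteq> {x \<in> E. q x \<in> q ` S}" using sub[OF that(1)] that(2) by blast
  qed
  have arc: "free_arc X q s t" if n: "n \<in> {1..N}" and st: "s < t" "a n < s" "t < b n" for n s t
    unfolding free_arc_def
  proof (intro conjI allI impI)
    have "{s..t} \<subseteq> E" using sub[OF n] st by fastforce
    moreover have "continuous_map (top_of_set E) X q"
      using q quotient_imp_continuous_map unfolding E_def by blast
    ultimately show "continuous_map (top_of_set {s..t}) X q"
      using continuous_map_from_subtopology_mono by blast
    fix u v :: real assume uv: "s \<le> u \<and> v \<le> t"
    then have o: "{u<..<v} \<subseteq> {a n<..<b n}" and c: "{u..v} \<subseteq> {a n<..<b n}" using st by auto
    have qo: "q ` {u<..<v} \<subseteq> topspace X" and qc: "q ` {u..v} \<subseteq> topspace X"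
      using sub[OF n] o c im by blast+
    have "openin (top_of_set E) {u<..<v}"
      by (rule open_subset) (use sub[OF n] o in auto)
    then show "openin X (q ` {u<..<v})"
      using openq[OF qo] sat[OF n o] by simp
    have "{x \<in> E. q x \<in> topspace X - q ` {u..v}} = E \<inter> - {u..v}"
      using sat[OF n c] im by blast
    then have "openin (top_of_set E) {x \<in> E. q x \<in> topspace X - q ` {u..v}}"
      by (metis closed_atLeastAtMost open_Compl openin_open_Int)
    then show "closedin X (q ` {u..v})"
      using openq[of "topspace X - q ` {u..v}"] qc by (simp add: closedin_def)
  qed (fact st)
  show ?thesis
  proof
    fix W assume W: "openin X W" "W \<noteq> {}"
    then have WX: "W \<subseteq> topspace X" by (simp add: openin_subset)
    obtain z where "z \<in> W" using W(2) by blast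
    moreover have "z \<in> q ` E" using \<open>z \<in> W\<close> WX im by auto
    ultimately obtain x where x: "x \<in> E" "q x \<in> W" by blast
    have "openin (top_of_set E) {x \<in> E. q x \<in> W}" using openq[OF WX] W by simp
    then obtain e where e: "e > 0" "\<And>y. y \<in> E \<Longrightarrow> dist y x < e \<Longrightarrow> q y \<in> W"
      using x unfolding openin_euclidean_subtopology_iff by blast
    obtain n where n: "n \<in> {1..N}" "a n \<le> x" "x \<le> b n" using x unfolding E_def by auto
    define c d where "c = max (a n) (x - e)" and "d = min (b n) (x + e)"
    have "c < d" using n ab e(1) unfolding c_def d_def by fastforce
    then obtain s where s: "c < s" "s < d" using dense by blast
    then obtain t where t: "s < t" "t < d" using dense by blast
    have "q y \<in> W" if "y \<in> {s..t}" for y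
    proof (rule e(2))
      have y: "c < y" "y < d" using that s t by auto
      then show "y \<in> E" using sub[OF n(1)] unfolding c_def d_def by auto
      show "dist y x < e" using y unfolding c_def d_def by (auto simp: dist_real_def)
    qed
    moreover have "free_arc X q s t"
      using arc[OF n(1)] s t unfolding c_def d_def by simp
    ultimately show "\<exists>s t. free_arc X q s t \<and> q ` {s..t} \<subseteq> W" by blast
  qed
qed

text \<open>
  Without \<open>q u\<close> and \<open>q v\<close>, the open arc between them is both open and closed, so a connected set
  that avoids these two points cannot straddle it.
\<close>

lemma free_arc_trap:
  assumes "free_arc X q s t" "s \<le> u" "v \<le> t" "u \<le> v"
    and C: "connectedin X C" and miss: "q u \<notin> C" "q v \<notin> C" and meet: "C \<inter> q ` {u<..<v} \<noteq> {}"
  shows "C \<subseteq> q ` {u<..<v}"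
proof (rule ccontr)
  assume "\<not> C \<subseteq> q ` {u<..<v}"
  moreover have "{u..v} = insert u (insert v {u<..<v})" using \<open>u \<le> v\<close> by auto
  then have eq: "C \<inter> q ` {u..v} = C \<inter> q ` {u<..<v}" using miss by auto
  ultimately have out: "(topspace X - q ` {u..v}) \<inter> C \<noteq> {}"
    using connectedin_subset_topspace[OF C] by blast
  have "openin X (q ` {u<..<v})" "openin X (topspace X - q ` {u..v})"
    using assms(1-3) unfolding free_arc_def by (auto simp: openin_diff)
  moreover have "C \<subseteq> q ` {u<..<v} \<union> (topspace X - q ` {u..v})"
    using eq connectedin_subset_topspace[OF C] by blast
  moreover have "q ` {u<..<v} \<inter> (topspace X - q ` {u..v}) \<inter> C = {}" using eq by blast
  ultimately show False using connectedinD[OF C] out meet by blast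
qed

text \<open>
  If \<open>C\<close> missed a point of the left part and a point of the right part, it would be trapped
  between these two points.
\<close>

lemma free_arc_cover_outer_part:
  assumes arc: "free_arc X q s t" and p: "s < p" "p < r" "r < t"
    and C: "connectedin X C" and meet: "C \<inter> q ` {p<..<r} \<noteq> {}" and leave: "\<not> C \<subseteq> q ` {s..t}"
  shows "q ` {s..p} \<subseteq> C \<or> q ` {r..t} \<subseteq> C"
proof (rule ccontr)
  assume "\<not> ?thesis"
  then obtain u v where u: "u \<in> {s..p}" "q u \<notin> C" and v: "v \<in> {r..t}" "q v \<notin> C" by blast
  have "{p<..<r} \<subseteq> {u<..<v}" using u v by auto
  then have "C \<subseteq> q ` {u<..<v}"
    using free_arc_trap[OF arc, of u v C] u v p C meet by fastforce
  then show False using leave u v by fastforce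
qed

section \<open>Horseshoes give positive entropy\<close>

text \<open>
  Points with a prescribed itinerary are found backwards, pulling a point of the last set back
  along the coverings. The labels allow for not knowing which set carrying the wanted label is
  covered.
\<close>

lemma covering_relation_itinerary:
  fixes J :: "'k \<Rightarrow> 'a set" and lab :: "'k \<Rightarrow> 'c"
  assumes ne: "\<And>k. J k \<noteq> {}"
    and cover: "\<And>k c. \<exists>l. lab l = c \<and> J l \<subseteq> g ` J k"
  shows "lab k = w 0 \<Longrightarrow> \<exists>x\<in>J k. \<forall>i\<le>K. \<exists>l. lab l = w i \<and> (g ^^ i) x \<in> J l"
proof (induction K arbitrary: k w)
  case 0
  then show ?case using ne by fastforce
next
  case (Suc K)
  obtain l where l: "lab l = w (Suc 0)" "J l \<subseteq> g ` J k" using cover by blast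
  obtain y where y: "y \<in> J l" "\<And>i. i \<le> K \<Longrightarrow> \<exists>l. lab l = w (Suc i) \<and> (g ^^ i) y \<in> J l"
    using Suc.IH[of l "\<lambda>i. w (Suc i)"] l(1) by blast
  obtain x where x: "x \<in> J k" "y = g x" using l(2) y(1) by blast
  have "\<exists>l. lab l = w i \<and> (g ^^ i) x \<in> J l" if "i \<le> Suc K" for i
  proof (cases i)
    case 0
    then show ?thesis using x(1) Suc.prems by auto
  next
    case (Suc j)
    then show ?thesis using y(2)[of j] that x(2) by (simp add: funpow_swap1)
  qed
  then show ?case using x(1) by blast
qed

text \<open>
  Each of the \<open>2 ^ k\<close> words has a point that follows it, and a member of the join contains at most
  one of these points: at time \<open>n * i\<close> it avoids \<open>A True\<close> or \<open>A False\<close>, which fixes the \<open>i\<close>-th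
  letter.
\<close>

lemma horseshoe_cover_number:
  assumes disj: "A True \<inter> A False = {}"
    and h: "\<And>w. \<exists>y\<in>topspace Y. \<forall>i<k. (S ^^ (n * i)) y \<in> A (w i)"
    and S: "continuous_map Y Y S" and n: "0 < n"
  shows "2 ^ k \<le> cover_number Y (cover_join Y S {topspace Y - A True, topspace Y - A False} (n * k))"
proof -
  define \<U> where "\<U> = {topspace Y - A True, topspace Y - A False}"
  define \<J> where "\<J> = cover_join Y S \<U> (n * k)"
  let ?P = "\<lambda>c. \<exists>\<V>\<subseteq>\<J>. finite \<V> \<and> card \<V> = c \<and> topspace Y \<subseteq> \<Union>\<V>"
  have join: "\<exists>U. (\<forall>i<n*k. U i \<in> \<U>) \<and> B = {x \<in> topspace Y. \<forall>i<n*k. (S ^^ i) x \<in> U i}"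
    if "B \<in> \<J>" for B
    using that unfolding \<J>_def cover_join_def by blast
  have excl: "b = c" if "V \<in> \<U>" "z \<in> V" "z' \<in> V" "z \<in> A b" "z' \<in> A c" for V z z' b c
    using that unfolding \<U>_def by (cases b; cases c) auto
  \<comment> \<open>Words of length \<open>k\<close> are encoded as subsets of \<open>{..<k}\<close>.\<close>
  have bound: "2 ^ k \<le> card \<V>" if \<V>: "\<V> \<subseteq> \<J>" "finite \<V>" "topspace Y \<subseteq> \<Union>\<V>" for \<V>
  proof -
    have "\<forall>w. \<exists>y. y \<in> topspace Y \<and> (\<forall>i<k. (S ^^ (n * i)) y \<in> A (i \<in> w))"
      using h[of "\<lambda>i. i \<in> w" for w] by meson
    then obtain y where y: "\<And>w. y w \<in> topspace Y" "\<And>w i. i < k \<Longrightarrow> (S ^^ (n * i)) (y w) \<in> A (i \<in> w)"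
      by metis
    have "\<forall>w. \<exists>B. B \<in> \<V> \<and> y w \<in> B" using y(1) \<V>(3) by blast
    then obtain B where B: "\<And>w. B w \<in> \<V>" "\<And>w. y w \<in> B w" by metis
    have "inj_on B (Pow {..<k})"
    proof (rule inj_onI)
      fix w v assume wv: "w \<in> Pow {..<k}" "v \<in> Pow {..<k}" "B w = B v"
      have "B w \<in> \<J>" using B(1) \<V>(1) by blast
      then obtain U where U: "\<forall>i<n*k. U i \<in> \<U>" "B w = {x \<in> topspace Y. \<forall>i<n*k. (S ^^ i) x \<in> U i}"
        using join by meson
      have "(i \<in> w) = (i \<in> v)" if i: "i < k" for i
      proof -
        have ni: "n * i < n * k" using i n by simp
        have "y w \<in> B w" "y v \<in> B w" using B(2)[of w] B(2)[of v] wv(3) by simp_all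
        then have "(S ^^ (n * i)) (y w) \<in> U (n * i)" "(S ^^ (n * i)) (y v) \<in> U (n * i)"
          using ni unfolding U(2) by simp_all
        then show ?thesis using excl U(1) ni y(2)[OF i] by meson
      qed
      then show "w = v" using wv(1,2) by blast
    qed
    moreover have "B ` Pow {..<k} \<subseteq> \<V>" using B(1) by blast
    ultimately have "card (Pow {..<k}) \<le> card \<V>"
      using \<V>(2) by (rule card_inj_on_le)
    then show ?thesis by (simp add: card_Pow)
  qed
  \<comment> \<open>The least cardinality is attained, since the join is itself a finite cover.\<close>
  have "Ex ?P"
  proof -
    let ?f = "\<lambda>U. {x \<in> topspace Y. \<forall>i<n*k. (S ^^ i) x \<in> U i}"
    have "\<J> \<subseteq> ?f ` (PiE {..<n*k} (\<lambda>_. \<U>))"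
    proof
      fix B assume "B \<in> \<J>"
      then obtain U where U: "\<forall>i<n*k. U i \<in> \<U>" "B = ?f U" using join by meson
      have "restrict U {..<n*k} \<in> PiE {..<n*k} (\<lambda>_. \<U>)" using U(1) by auto
      moreover have "B = ?f (restrict U {..<n*k})" unfolding U(2) by simp
      ultimately show "B \<in> ?f ` (PiE {..<n*k} (\<lambda>_. \<U>))" by (rule rev_image_eqI[where f = ?f])
    qed
    moreover have "finite (?f ` (PiE {..<n*k} (\<lambda>_. \<U>)))"
      by (intro finite_imageI finite_PiE) (simp_all add: \<U>_def)
    ultimately have "finite \<J>" by (rule finite_subset)
    moreover have "topspace Y \<subseteq> \<Union>\<J>"
    proof
      fix x assume x: "x \<in> topspace Y"
      have "\<exists>V. V \<in> \<U> \<and> (S ^^ i) x \<in> V" for i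
        using funpow_topspace[OF S x, of i] disj unfolding \<U>_def by blast
      then obtain U where U: "\<And>i. U i \<in> \<U> \<and> (S ^^ i) x \<in> U i" by metis
      then have "?f U \<in> \<J>"
        unfolding \<J>_def cover_join_def by (intro CollectI exI[of _ U]) simp
      moreover have "x \<in> ?f U" using x U by simp
      ultimately show "x \<in> \<Union>\<J>" by (rule UnionI)
    qed
    ultimately show ?thesis by (intro exI[of _ "card \<J>"] exI[of _ \<J>]) simp
  qed
  then have "?P (cover_number Y \<J>)" unfolding cover_number_def by (rule LeastI_ex)
  then obtain \<V> where "\<V> \<subseteq> \<J>" "finite \<V>" "card \<V> = cover_number Y \<J>" "topspace Y \<subseteq> \<Union>\<V>"
    by blast
  then show ?thesis using bound[of \<V>] unfolding \<J>_def \<U>_def by simp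
qed

lemma horseshoe_positive_entropy:
  assumes S: "continuous_map Y Y S" and n: "0 < n"
    and closed: "\<And>b. closedin Y (A b)" and disj: "A True \<inter> A False = {}"
    and h: "\<And>k w. \<exists>y\<in>topspace Y. \<forall>i<k. (S ^^ (n * i)) y \<in> A (w i)"
  shows "0 < topological_entropy Y S"
proof -
  let ?U = "{topspace Y - A True, topspace Y - A False}"
  let ?f = "\<lambda>l. ereal (ln (real (cover_number Y (cover_join Y S ?U l))) / real l)"
  \<comment> \<open>Joins are counted along positive multiples of \<open>n\<close>; length \<open>0\<close> would give the ratio \<open>0\<close>.\<close>
  define r where "r = (\<lambda>k. n * Suc k)"
  have "ereal (ln 2 / real n) \<le> (?f \<circ> r) k" for k
  proof -
    have "real (2 ^ Suc k) \<le> real (cover_number Y (cover_join Y S ?U (r k)))"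
      using horseshoe_cover_number[OF disj h S n, where k = "Suc k"] unfolding r_def of_nat_le_iff .
    then have "ln (2 ^ Suc k) \<le> ln (real (cover_number Y (cover_join Y S ?U (r k))))"
      by (simp add: ln_mono)
    moreover have "ln (2 ^ Suc k) = real (Suc k) * ln (2::real)" by (rule ln_realpow)
    moreover have "ln 2 / real n = real (Suc k) * ln 2 / real (r k)"
      unfolding r_def of_nat_mult by (simp del: of_nat_Suc)
    ultimately show ?thesis by (simp add: divide_right_mono)
  qed
  then have "ereal (ln 2 / real n) \<le> limsup (?f \<circ> r)"
    by (intro le_Limsup always_eventually allI) simp_all
  also have "\<dots> \<le> limsup ?f"
    using n by (intro limsup_subseq_mono) (simp add: strict_mono_def r_def)
  also have "\<dots> = cover_entropy Y S ?U" by (simp add: cover_entropy_def)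
  also have "\<dots> \<le> topological_entropy Y S"
  proof -
    have "open_cover Y ?U"
      unfolding open_cover_def using closed disj by (auto simp: openin_diff)
    then show ?thesis unfolding topological_entropy_def by (auto intro: SUP_upper)
  qed
  finally have "ereal (ln 2 / real n) \<le> topological_entropy Y S" .
  moreover have "0 < ereal (ln 2 / real n)" using n by simp
  ultimately show ?thesis by (rule less_le_trans[rotated])
qed

section \<open>Mixing graph maps have completely positive entropy\<close>

lemma mixing_graph_factor_positive_entropy:
  fixes X :: "'a topology" and Y :: "'b topology"
  assumes graph: "topological_graph X" and T: "continuous_map X X T" and mix: "mixing X T"
    and Y: "tds Y S" and fac: "is_factor X T Y S" and nontriv: "\<not> (\<exists>y. topspace Y = {y})"
  shows "0 < topological_entropy Y S"
proof -
  have S: "continuous_map Y Y S" and haus: "Hausdorff_space Y"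
    using Y metrizable_imp_Hausdorff_space unfolding tds_def by auto
  obtain \<phi> where \<phi>: "continuous_map X Y \<phi>" and surj: "\<phi> ` topspace X = topspace Y"
      and com: "\<And>x. x \<in> topspace X \<Longrightarrow> \<phi> (T x) = S (\<phi> x)"
    using fac unfolding is_factor_def by blast
  have iter: "\<phi> ((T ^^ i) x) = (S ^^ i) (\<phi> x)" if "x \<in> topspace X" for i x
    using that by (induction i) (simp_all add: com funpow_topspace[OF T])
  obtain q where q: "\<And>W. openin X W \<Longrightarrow> W \<noteq> {} \<Longrightarrow> \<exists>s t. free_arc X q s t \<and> q ` {s..t} \<subseteq> W"
    using topological_graph_free_arcs[OF graph] by blast
  obtain y0 y1 where y: "y0 \<in> topspace Y" "y1 \<in> topspace Y" "y0 \<noteq> y1"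
    using nontriv surj topological_graph_compact_nonempty(2)[OF graph]
    by (metis all_not_in_conv image_is_empty is_singletonI' is_singleton_def)
  then obtain O0 O1 where O01: "openin Y O0" "openin Y O1" "y0 \<in> O0" "y1 \<in> O1" "disjnt O0 O1"
    using haus unfolding Hausdorff_space_def by metis
  define W where "W = (\<lambda>b. {x \<in> topspace X. \<phi> x \<in> (if b then O1 else O0)})"
  have "openin X (W b)" "W b \<noteq> {}" for b
    using openin_continuous_map_preimage[OF \<phi>] O01 y surj unfolding W_def by (cases b; force)+
  then have "\<forall>b. \<exists>s t. free_arc X q s t \<and> q ` {s..t} \<subseteq> W b" using q by blast
  then obtain s t where arc: "\<And>b. free_arc X q (s b) (t b)" and inW: "\<And>b. q ` {s b..t b} \<subseteq> W b"
    by metis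
  have Wdisj: "W b \<inter> W (\<not> b) = {}" for b
    using O01(5) unfolding W_def disjnt_def by (cases b) auto
  have st: "s b < t b" for b using arc unfolding free_arc_def by blast
  define p r where "p = (\<lambda>b. s b + (t b - s b) / 3)" and "r = (\<lambda>b. t b - (t b - s b) / 3)"
  have pr: "s b < p b" "p b < r b" "r b < t b" for b
    using st[of b] unfolding p_def r_def by (simp_all add: field_simps)
  \<comment> \<open>The index \<open>(b, c)\<close> is the left (\<open>c = False\<close>) or right (\<open>c = True\<close>) third of the arc in \<open>W b\<close>.\<close>
  define lo hi where "lo = (\<lambda>(b, c). if c then r b else s b)" and "hi = (\<lambda>(b, c). if c then t b else p b)"
  have lohi: "s (fst k) \<le> lo k" "lo k < hi k" "hi k \<le> t (fst k)" for k
    using pr[of "fst k"] unfolding lo_def hi_def by (auto simp: case_prod_unfold)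
  define J where "J = (\<lambda>k. q ` {lo k..hi k})"
  have cont: "continuous_map (top_of_set {lo k..hi k}) X q" for k
  proof (rule continuous_map_from_subtopology_mono)
    show "continuous_map (top_of_set {s (fst k)..t (fst k)}) X q"
      using arc unfolding free_arc_def by blast
    show "{lo k..hi k} \<subseteq> {s (fst k)..t (fst k)}" using lohi[of k] by auto
  qed
  have JW: "J k \<subseteq> W (fst k)" for k
  proof -
    have "{lo k..hi k} \<subseteq> {s (fst k)..t (fst k)}" using lohi[of k] by auto
    then show ?thesis using inW unfolding J_def by blast
  qed
  have JX: "J k \<subseteq> topspace X" for k using JW unfolding W_def by blast
  have Jconn: "connectedin X (J k)" for k
    unfolding J_def
    by (rule connectedin_continuous_map_image[OF cont[of k]]) (simp add: connectedin_subtopology)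
  have Jcomp: "compactin X (J k)" for k
    unfolding J_def by (rule image_compactin[OF _ cont[of k]]) (simp add: compactin_subtopology)
  define V mid where "V = (\<lambda>k. q ` {lo k<..<hi k})" and "mid = (\<lambda>b. q ` {p b<..<r b})"
  have V: "openin X (V k)" "V k \<noteq> {}" "V k \<subseteq> J k" for k
  proof -
    show "openin X (V k)"
      using arc[of "fst k"] lohi[of k] unfolding V_def free_arc_def by blast
    show "V k \<noteq> {}" "V k \<subseteq> J k" using lohi(2)[of k] unfolding V_def J_def by auto
  qed
  have mid: "openin X (mid b)" "mid b \<noteq> {}" "mid b \<subseteq> W b" for b
  proof -
    have "s b \<le> p b" "r b \<le> t b" using pr[of b] by simp_all
    then show "openin X (mid b)" using arc[of b] unfolding mid_def free_arc_def by blast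
    show "mid b \<noteq> {}" using pr(2)[of b] unfolding mid_def by simp
    have "{p b<..<r b} \<subseteq> {s b..t b}" using pr[of b] by auto
    then show "mid b \<subseteq> W b" using inW unfolding mid_def by blast
  qed
  \<comment> \<open>Only eight pairs of open sets are involved, so one \<open>n\<close> serves all of them.\<close>
  have "\<forall>\<^sub>F n in sequentially. {x \<in> topspace X. (T ^^ n) x \<in> mid b} \<inter> V k \<noteq> {}" for b k
    using mix mid(1,2)[of b] V(1,2)[of k] unfolding mixing_def eventually_sequentially by meson
  then have "\<forall>\<^sub>F n in sequentially. \<forall>b k. {x \<in> topspace X. (T ^^ n) x \<in> mid b} \<inter> V k \<noteq> {}"
    by (intro eventually_all_finite)
  then have "\<forall>\<^sub>F n in sequentially.
      0 < n \<and> (\<forall>b k. {x \<in> topspace X. (T ^^ n) x \<in> mid b} \<inter> V k \<noteq> {})"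
    by (intro eventually_conj eventually_gt_at_top)
  then obtain n where n: "0 < n" "\<And>b k. {x \<in> topspace X. (T ^^ n) x \<in> mid b} \<inter> V k \<noteq> {}"
    using eventually_happens' sequentially_bot by blast
  have cover: "\<exists>l. fst l = b \<and> J l \<subseteq> (T ^^ n) ` J k" for b k
  proof -
    let ?C = "(T ^^ n) ` J k"
    have conn: "connectedin X ?C"
      using connectedin_continuous_map_image continuous_map_funpow[OF T] Jconn by blast
    have meets: "?C \<inter> mid c \<noteq> {}" for c using n(2)[where b = c and k = k] V(3)[of k] by blast
    \<comment> \<open>The middle part of the other arc shows that the image is not confined to this one.\<close>
    have "\<not> ?C \<subseteq> q ` {s b..t b}"
      using meets[of "\<not> b"] mid(3)[of "\<not> b"] Wdisj[of b] inW[of b] by blast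
    then have "q ` {s b..p b} \<subseteq> ?C \<or> q ` {r b..t b} \<subseteq> ?C"
      using free_arc_cover_outer_part[OF arc pr conn] meets unfolding mid_def by blast
    then have "J (b, False) \<subseteq> ?C \<or> J (b, True) \<subseteq> ?C"
      unfolding J_def lo_def hi_def by simp
    then show ?thesis by (metis fst_conv)
  qed
  have Jne: "J k \<noteq> {}" for k using lohi(2)[of k] unfolding J_def by auto
  define A where "A = (\<lambda>b. \<phi> ` (J (b, False) \<union> J (b, True)))"
  show ?thesis
  proof (rule horseshoe_positive_entropy[OF S n(1)])
    show "closedin Y (A b)" for b
      unfolding A_def
      by (intro compactin_imp_closedin[OF haus] image_compactin[OF _ \<phi>] compactin_Un Jcomp)
    have AO: "A b \<subseteq> (if b then O1 else O0)" for b
      using JW[of "(b, False)"] JW[of "(b, True)"] unfolding A_def W_def by auto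
    show "A True \<inter> A False = {}"
      using AO[of True] AO[of False] O01(5) unfolding disjnt_def by auto
    show "\<exists>y\<in>topspace Y. \<forall>i<k. (S ^^ (n * i)) y \<in> A (w i)" for k w
    proof -
      obtain x where x: "x \<in> J (w 0, False)"
          "\<And>i. i \<le> k \<Longrightarrow> \<exists>l. fst l = w i \<and> ((T ^^ n) ^^ i) x \<in> J l"
        using covering_relation_itinerary[of J fst "T ^^ n" "(w 0, False)" w k] Jne cover by auto
      have xX: "x \<in> topspace X" using x(1) JX by blast
      have "(S ^^ (n * i)) (\<phi> x) \<in> A (w i)" if i: "i < k" for i
      proof -
        obtain l where l: "fst l = w i" "(T ^^ (n * i)) x \<in> J l"
          using x(2)[of i] i by (auto simp: funpow_mult)
        then have "J l \<subseteq> J (w i, False) \<union> J (w i, True)" by (cases l; cases "snd l") auto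
        then have "\<phi> ((T ^^ (n * i)) x) \<in> A (w i)" using l unfolding A_def by blast
        then show ?thesis by (simp add: iter[OF xX])
      qed
      moreover have "\<phi> x \<in> topspace Y" using xX surj by blast
      ultimately show ?thesis by blast
    qed
  qed
qed

theorem corollary3p9:
  fixes X :: "'a topology" and m :: "'a metric"
  assumes "topological_graph X"
    and "mtopology_of m = X"
  shows "Mix X \<inter> CPE X \<in> borel_sets_of (mtopology_of (cfunspace X m))"
proof -
  have "Mix X \<subseteq> CPE X"
    using mixing_graph_factor_positive_entropy[OF assms(1)]
    unfolding Mix_def CPE_def TDS_def has_CPE_def by blast
  then have "Mix X \<inter> CPE X = Mix X" by blast
  then show ?thesis
    using Mix_borel[OF assms(2) topological_graph_compact_nonempty(1)[OF assms(1)]] by simp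
qed

end
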